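(* Let $M$ be a smooth manifold, $\{X_i\}_{i=1}^m$ a finite set of smooth vector fields on $M$, and $f=(f_1,\dots,f_m)\in C^\infty(M,\mathbb{R}^m)$. Then for every probability distribution $\rho(\varepsilon)$ on $\mathbb{R}^m$ with zero mean $\mathbb{E}_{\rho(\varepsilon)}[\varepsilon]=0$ and identity covariance $\mathrm{Cov}_{\rho(\varepsilon)}[\varepsilon]=I$, the following holds (at every point of $M$): $$\sum_{i=1}^m df_i(X_i)=\mathbb{E}_{\rho(\varepsilon)}\Big[(f^*\varepsilon)\Big(\sum_{i=1}^m\varepsilon_iX_i\Big)\Big].$$ Moreover, if $f=f^{(2)}\circ f^{(1)}$ is a composition of two smooth functions $f^{(1)}:M\to N$ and $f^{(2)}:N\to\mathbb{R}^m$ ($N$ a smooth manifold), then this quantity also equals $$\mathbb{E}_{\rho(\varepsilon)}\Big[\big((f^{(2)})^*\varepsilon\big)\Big(df^{(1)}\Big(\sum_{i=1}^m\varepsilon_iX_i\Big)\Big)\Big].$$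
   Context: A vector $\varepsilon=(\varepsilon_1,\dots,\varepsilon_m)\in\mathbb{R}^m$ is regarded as the constant covector $\sum_i\varepsilon_i\,dx_i$ on $\mathbb{R}^m$. For a smooth map $h=(h_1,\dots,h_m)$ from a manifold to $\mathbb{R}^m$, $h^*\varepsilon$ denotes its pullback 1-form, $(h^*\varepsilon)(v)=\sum_{i=1}^m\varepsilon_i\,dh_i(v)$ for tangent vectors $v$. *)

theory Defs
  imports "HOL-Probability.Probability"
begin

text \<open>Smooth maps between open subsets of finite-dimensional normed spaces.  There it suffices
  to iterate directional derivatives; \<open>S\<close> is always meant to be open.\<close>

primrec times_cont_diff_on ::
    "nat \<Rightarrow> 'e::real_normed_vector set \<Rightarrow> ('e \<Rightarrow> 'v::real_normed_vector) \<Rightarrow> bool" where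
  "times_cont_diff_on 0 S f \<longleftrightarrow> continuous_on S f"
| "times_cont_diff_on (Suc k) S f \<longleftrightarrow>
     (\<forall>x\<in>S. f differentiable (at x)) \<and>
     (\<forall>w. times_cont_diff_on k S (\<lambda>x. frechet_derivative f (at x) w))"

definition smooth_on :: "'e::real_normed_vector set \<Rightarrow> ('e \<Rightarrow> 'v::real_normed_vector) \<Rightarrow> bool" where
  "smooth_on S f \<longleftrightarrow> (\<forall>k. times_cont_diff_on k S f)"


text \<open>A manifold is given by a topology and an arbitrary (not necessarily maximal) smooth atlas;
  a chart \<open>(U, \<phi>)\<close> has domain \<open>U\<close>, and the values of \<open>\<phi>\<close> outside \<open>U\<close> are irrelevant.  The model
  space \<open>'e\<close> is a finite-dimensional normed space instead of a \<open>euclidean_space\<close> because the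
  latter class would exclude dimension zero.\<close>

record ('a, 'e) manifold =
  mtop :: "'a topology"
  atlas :: "('a set \<times> ('a \<Rightarrow> 'e)) set"

abbreviation points :: "('a, 'e) manifold \<Rightarrow> 'a set" where
  "points M \<equiv> topspace (mtop M)"

definition is_chart :: "'a topology \<Rightarrow> 'a set \<times> ('a \<Rightarrow> 'e::real_normed_vector) \<Rightarrow> bool" where
  "is_chart T = (\<lambda>(U, \<phi>). openin T U \<and> open (\<phi> ` U) \<and>
     homeomorphic_map (subtopology T U) (top_of_set (\<phi> ` U)) \<phi>)"

definition smooth_manifold :: "('a, 'e::real_normed_vector) manifold \<Rightarrow> bool" where
  "smooth_manifold M \<longleftrightarrow>
     (\<exists>B :: 'e set. finite B \<and> span B = UNIV) \<and>
     Hausdorff_space (mtop M) \<and> second_countable (mtop M) \<and>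
     (\<forall>c\<in>atlas M. is_chart (mtop M) c) \<and>
     (\<Union>(U, \<phi>)\<in>atlas M. U) = points M \<and>
     (\<forall>(U, \<phi>)\<in>atlas M. \<forall>(V, \<psi>)\<in>atlas M. smooth_on (\<phi> ` (U \<inter> V)) (\<psi> \<circ> inv_into U \<phi>))"

definition smooth_fun ::
    "('a, 'e::real_normed_vector) manifold \<Rightarrow> ('a \<Rightarrow> 'v::real_normed_vector) \<Rightarrow> bool" where
  "smooth_fun M f \<longleftrightarrow> (\<forall>(U, \<phi>)\<in>atlas M. smooth_on (\<phi> ` U) (f \<circ> inv_into U \<phi>))"

definition smooth_map ::
    "('a, 'e::real_normed_vector) manifold \<Rightarrow> ('b, 'e2::real_normed_vector) manifold \<Rightarrow>
     ('a \<Rightarrow> 'b) \<Rightarrow> bool" where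
  "smooth_map M N F \<longleftrightarrow> continuous_map (mtop M) (mtop N) F \<and>
     (\<forall>(U, \<phi>)\<in>atlas M. \<forall>(V, \<psi>)\<in>atlas N.
        smooth_on (\<phi> ` (U \<inter> F -` V)) (\<psi> \<circ> F \<circ> inv_into U \<phi>))"


text \<open>Tangent vectors at \<open>p\<close> are the derivations at \<open>p\<close> of the algebra of smooth real functions.
  As they are represented by functionals on all functions, they are normalised to be zero on
  non-smooth ones.\<close>

type_synonym 'a tangent = "('a \<Rightarrow> real) \<Rightarrow> real"

definition tangent_space :: "('a, 'e::real_normed_vector) manifold \<Rightarrow> 'a \<Rightarrow> 'a tangent set" where
  "tangent_space M p = {v.
     (\<forall>g h a b. smooth_fun M g \<longrightarrow> smooth_fun M h \<longrightarrow>
        v (\<lambda>x. a * g x + b * h x) = a * v g + b * v h) \<and>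
     (\<forall>g h. smooth_fun M g \<longrightarrow> smooth_fun M h \<longrightarrow>
        v (\<lambda>x. g x * h x) = g p * v h + h p * v g) \<and>
     (\<forall>g. \<not> smooth_fun M g \<longrightarrow> v g = 0)}"

definition smooth_vector_field ::
    "('a, 'e::real_normed_vector) manifold \<Rightarrow> ('a \<Rightarrow> 'a tangent) \<Rightarrow> bool" where
  "smooth_vector_field M X \<longleftrightarrow>
     (\<forall>p\<in>points M. X p \<in> tangent_space M p) \<and>
     (\<forall>g :: 'a \<Rightarrow> real. smooth_fun M g \<longrightarrow> smooth_fun M (\<lambda>p. X p g))"

definition tangent_comb :: "real ^ 'm \<Rightarrow> ('m::finite \<Rightarrow> 'a tangent) \<Rightarrow> 'a tangent" where
  "tangent_comb \<epsilon> v = (\<lambda>g. \<Sum>i\<in>UNIV. \<epsilon> $ i * v i g)"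

text \<open>The differential of a real function, and of a map into the manifold \<open>N\<close>.\<close>

definition d_fun :: "('a \<Rightarrow> real) \<Rightarrow> 'a tangent \<Rightarrow> real" where
  "d_fun g v = v g"

definition d_map ::
    "('b, 'e2::real_normed_vector) manifold \<Rightarrow> ('a \<Rightarrow> 'b) \<Rightarrow> 'a tangent \<Rightarrow> 'b tangent" where
  "d_map N F v = (\<lambda>g. if smooth_fun N g then v (g \<circ> F) else 0)"

definition pullback :: "('a \<Rightarrow> real ^ 'm::finite) \<Rightarrow> real ^ 'm \<Rightarrow> 'a tangent \<Rightarrow> real" where
  "pullback h \<epsilon> v = (\<Sum>i\<in>UNIV. \<epsilon> $ i * d_fun (\<lambda>x. h x $ i) v)"


text \<open>Existence of the moments has to be demanded, since the Bochner integral of a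
  non-integrable function is zero.\<close>

definition has_mean :: "(real ^ 'm::finite) measure \<Rightarrow> real ^ 'm \<Rightarrow> bool" where
  "has_mean \<rho> \<mu> \<longleftrightarrow> has_bochner_integral \<rho> (\<lambda>\<epsilon>. \<epsilon>) \<mu>"

definition has_covariance :: "(real ^ 'm::finite) measure \<Rightarrow> real ^ 'm ^ 'm \<Rightarrow> bool" where
  "has_covariance \<rho> C \<longleftrightarrow> (\<exists>\<mu>. has_mean \<rho> \<mu> \<and>
     (\<forall>i j. has_bochner_integral \<rho> (\<lambda>\<epsilon>. (\<epsilon> $ i - \<mu> $ i) * (\<epsilon> $ j - \<mu> $ j)) (C $ i $ j)))"

end

theory Submission
  imports Defs
begin

text \<open>In coordinates, \<open>(f\<^sup>*\<epsilon>)(\<Sum>\<^sub>j \<epsilon>\<^sub>j X\<^sub>j) = \<Sum>\<^sub>i\<^sub>j \<epsilon>\<^sub>i \<epsilon>\<^sub>j df\<^sub>i(X\<^sub>j)\<close>, and the second moments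
  \<open>E[\<epsilon>\<^sub>i \<epsilon>\<^sub>j] = \<delta>\<^sub>i\<^sub>j\<close> pick out the trace.  The composite case has the same integrand:
  as \<open>f\<close> and \<open>f2 \<circ> f1\<close> need only agree on the points of \<open>M\<close>, this uses that a derivation does not
  see the values of a function outside \<open>M\<close>.\<close>

text \<open>Openness is essential: \<open>frechet_derivative\<close> at a point of \<open>S\<close>
  depends on the values in a neighbourhood, so agreement on an open \<open>S\<close> passes to all
  directional derivatives by induction.\<close>

lemma times_cont_diff_on_cong:
  assumes "open S" and "\<And>x. x \<in> S \<Longrightarrow> f x = g x" and "times_cont_diff_on k S f"
  shows "times_cont_diff_on k S g"
  using assms(2,3)
proof (induction k arbitrary: f g)
  case 0
  then show ?case
    by (simp cong: continuous_on_cong)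
next
  case (Suc k)
  have "g differentiable (at x)" if "x \<in> S" for x
    using Suc.prems that \<open>open S\<close>
    unfolding differentiable_def times_cont_diff_on.simps
    by (blast intro: has_derivative_transform_within_open)
  moreover have "times_cont_diff_on k S (\<lambda>x. frechet_derivative g (at x) w)" for w
  proof (rule Suc.IH)
    show "times_cont_diff_on k S (\<lambda>x. frechet_derivative f (at x) w)"
      using Suc.prems by simp
    show "frechet_derivative f (at x) w = frechet_derivative g (at x) w" if "x \<in> S" for x
      using Suc.prems that \<open>open S\<close>
      by (metis frechet_derivative_transform_within_open times_cont_diff_on.simps(2))
  qed
  ultimately show ?case
    by simp
qed

text \<open>The derivative of \<open>L\<close> after \<open>f\<close> in direction \<open>w\<close>
  is \<open>L\<close> applied to that of \<open>f\<close>, which has the same shape one order lower.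
  Coordinate projections are the case of interest.\<close>

lemma times_cont_diff_on_bounded_linear:
  assumes "bounded_linear L" and "open S" and "times_cont_diff_on k S f"
  shows "times_cont_diff_on k S (\<lambda>x. L (f x))"
  using assms(3)
proof (induction k arbitrary: f)
  case 0
  then show ?case
    using assms(1) by (simp add: bounded_linear.continuous_on)
next
  case (Suc k)
  have deriv: "((\<lambda>x. L (f x)) has_derivative (\<lambda>w. L (frechet_derivative f (at x) w))) (at x)"
    if "x \<in> S" for x
  proof (rule bounded_linear.has_derivative[OF assms(1)])
    show "(f has_derivative frechet_derivative f (at x)) (at x)"
      using Suc.prems that by (simp add: frechet_derivative_works[symmetric])
  qed
  have "times_cont_diff_on k S (\<lambda>x. frechet_derivative (\<lambda>x. L (f x)) (at x) w)" for w
  proof (rule times_cont_diff_on_cong[OF \<open>open S\<close>])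
    show "times_cont_diff_on k S (\<lambda>x. L (frechet_derivative f (at x) w))"
      using Suc by simp
  qed (simp add: frechet_derivative_at[OF deriv, symmetric])
  then show ?case
    using deriv by (auto simp: differentiable_def)
qed

lemma times_cont_diff_on_zero: "times_cont_diff_on k S (\<lambda>x. 0)"
  by (induction k) auto

lemma smooth_manifold_open_chart:
  assumes "smooth_manifold M" and "(U, \<phi>) \<in> atlas M"
  shows "open (\<phi> ` U)" and "U \<subseteq> points M"
proof -
  have "is_chart (mtop M) (U, \<phi>)"
    using assms unfolding smooth_manifold_def by blast
  then show "open (\<phi> ` U)" and "U \<subseteq> points M"
    by (auto simp: is_chart_def dest: openin_subset)
qed

text \<open>On a chart image, \<open>inv_into U \<phi>\<close> takes values in \<open>U\<close>,
  hence in \<open>points M\<close>; values elsewhere in the type \<open>'a\<close> never enter a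
  coordinate representation.\<close>

lemma smooth_fun_cong:
  assumes M: "smooth_manifold M" and eq: "\<And>x. x \<in> points M \<Longrightarrow> f x = g x" and "smooth_fun M f"
  shows "smooth_fun M g"
  unfolding smooth_fun_def smooth_on_def
proof clarify
  fix U \<phi> k
  assume chart: "(U, \<phi>) \<in> atlas M"
  show "times_cont_diff_on k (\<phi> ` U) (g \<circ> inv_into U \<phi>)"
  proof (rule times_cont_diff_on_cong)
    show "open (\<phi> ` U)"
      by (rule smooth_manifold_open_chart(1)[OF M chart])
    show "(f \<circ> inv_into U \<phi>) y = (g \<circ> inv_into U \<phi>) y" if "y \<in> \<phi> ` U" for y
      using eq smooth_manifold_open_chart(2)[OF M chart] inv_into_into[OF that] by auto
    show "times_cont_diff_on k (\<phi> ` U) (f \<circ> inv_into U \<phi>)"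
      using chart \<open>smooth_fun M f\<close> unfolding smooth_fun_def smooth_on_def by blast
  qed
qed

lemma smooth_fun_bounded_linear:
  assumes "bounded_linear L" and M: "smooth_manifold M" and "smooth_fun M f"
  shows "smooth_fun M (\<lambda>x. L (f x))"
  unfolding smooth_fun_def smooth_on_def
proof clarify
  fix U \<phi> k
  assume chart: "(U, \<phi>) \<in> atlas M"
  then have "times_cont_diff_on k (\<phi> ` U) (f \<circ> inv_into U \<phi>)"
    using \<open>smooth_fun M f\<close> unfolding smooth_fun_def smooth_on_def by blast
  then show "times_cont_diff_on k (\<phi> ` U) ((\<lambda>x. L (f x)) \<circ> inv_into U \<phi>)"
    unfolding o_def
    by (rule times_cont_diff_on_bounded_linear[OF assms(1) smooth_manifold_open_chart(1)[OF M chart]])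
qed

lemma smooth_fun_zero: "smooth_fun M (\<lambda>x. 0)"
  by (simp add: smooth_fun_def smooth_on_def o_def times_cont_diff_on_zero)

lemma tangent_cong:
  assumes M: "smooth_manifold M" and p: "p \<in> points M" and v: "v \<in> tangent_space M p"
    and g: "smooth_fun M g" and eq: "\<And>x. x \<in> points M \<Longrightarrow> g x = h x"
  shows "v g = v h"
proof -
  define k where "k = (\<lambda>x. 1 * g x + (- 1) * h x)"
  \<comment> \<open>This indicator of the complement of M counts as smooth, since charts see only
    its zero values. Multiplying by it fixes every function that vanishes on M.\<close>
  define w where "w = (\<lambda>x. if x \<in> points M then 0 else 1 :: real)"
  have h: "smooth_fun M h"
    using smooth_fun_cong[OF M eq g] by blast
  have k0: "smooth_fun M k"
    by (rule smooth_fun_cong[OF M _ smooth_fun_zero]) (simp add: k_def eq)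
  have w0: "smooth_fun M w"
    by (rule smooth_fun_cong[OF M _ smooth_fun_zero]) (simp add: w_def)
  have "v k = 1 * v g + (- 1) * v h"
    using v g h unfolding tangent_space_def k_def by blast
  \<comment> \<open>Both factors of \<open>k = k * w\<close> vanish at \<open>p\<close>, so the Leibniz rule kills \<open>k = g - h\<close>.\<close>
  moreover have "v (\<lambda>x. k x * w x) = k p * v w + w p * v k"
    using v k0 w0 unfolding tangent_space_def by blast
  moreover have "(\<lambda>x. k x * w x) = k"
    by (auto simp: k_def w_def eq)
  moreover have "k p = 0" "w p = 0"
    using p by (auto simp: k_def w_def eq)
  ultimately show ?thesis
    by simp
qed

lemma has_covariance_mat_1_moments:
  assumes "has_mean \<rho> 0" and "has_covariance \<rho> (mat 1)"
  shows "has_bochner_integral \<rho> (\<lambda>\<epsilon>. \<epsilon> $ i * \<epsilon> $ j) (if i = j then 1 else 0)"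
proof -
  obtain \<mu> where \<mu>: "has_mean \<rho> \<mu>"
    and cov: "\<And>i j. has_bochner_integral \<rho> (\<lambda>\<epsilon>. (\<epsilon> $ i - \<mu> $ i) * (\<epsilon> $ j - \<mu> $ j)) (mat 1 $ i $ j)"
    using assms(2) unfolding has_covariance_def by blast
  \<comment> \<open>The covariance carries its own existentially quantified mean; uniqueness of the
    Bochner integral identifies it with the given one.\<close>
  have "\<mu> = 0"
    using assms(1) \<mu> unfolding has_mean_def by (rule has_bochner_integral_eq[symmetric])
  then show ?thesis
    using cov[of i j] by (simp add: mat_def)
qed

text \<open>Stating this for an arbitrary constant matrix \<open>A\<close> lets one instance, the
  matrix of all \<open>df_i(X_j)\<close> at a point, serve both integrands and yield integrability
  along with the value.\<close>

lemma has_bochner_integral_trace: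
  fixes A :: "'m::finite \<Rightarrow> 'm \<Rightarrow> real"
  assumes "has_mean \<rho> 0" and "has_covariance \<rho> (mat 1)"
  shows "has_bochner_integral \<rho> (\<lambda>\<epsilon>. \<Sum>i\<in>UNIV. \<epsilon> $ i * (\<Sum>j\<in>UNIV. \<epsilon> $ j * A i j))
           (\<Sum>i\<in>UNIV. A i i)"
proof -
  have "has_bochner_integral \<rho> (\<lambda>\<epsilon>. \<Sum>i\<in>UNIV. \<Sum>j\<in>UNIV. (\<epsilon> $ i * \<epsilon> $ j) * A i j)
          (\<Sum>i\<in>UNIV. \<Sum>j\<in>UNIV. (if i = j then 1 else 0) * A i j)"
    by (intro has_bochner_integral_sum has_bochner_integral_mult_left
        has_covariance_mat_1_moments[OF assms])
  then show ?thesis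
    \<comment> \<open>The Kronecker delta collapses each inner sum to its diagonal term.\<close>
    by (simp add: sum_distrib_left mult.assoc if_distrib[of "\<lambda>c. c * _"] cong: if_cong)
qed

theorem mainTheorem4:
  fixes M :: "('a, 'e::real_normed_vector) manifold"
    and X :: "'m::finite \<Rightarrow> 'a \<Rightarrow> 'a tangent"
    and f :: "'a \<Rightarrow> real ^ 'm"
    and \<rho> :: "(real ^ 'm) measure"
  assumes "smooth_manifold M"
    and "\<And>i. smooth_vector_field M (X i)"
    and "smooth_fun M f"
    and "prob_space \<rho>" and "sets \<rho> = sets borel"
    and "has_mean \<rho> 0" and "has_covariance \<rho> (mat 1)"
  shows "(\<forall>p\<in>points M.
            integrable \<rho> (\<lambda>\<epsilon>. pullback f \<epsilon> (tangent_comb \<epsilon> (\<lambda>i. X i p))) \<and>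
            (\<Sum>i\<in>UNIV. d_fun (\<lambda>x. f x $ i) (X i p)) =
              (\<integral>\<epsilon>. pullback f \<epsilon> (tangent_comb \<epsilon> (\<lambda>i. X i p)) \<partial>\<rho>)) \<and>
         (\<forall>(N :: ('b, 'e2::real_normed_vector) manifold) f1 f2.
            smooth_manifold N \<longrightarrow> smooth_map M N f1 \<longrightarrow> smooth_fun N f2 \<longrightarrow>
            (\<forall>p\<in>points M. f p = (f2 \<circ> f1) p) \<longrightarrow>
            (\<forall>p\<in>points M.
               integrable \<rho> (\<lambda>\<epsilon>. pullback f2 \<epsilon> (d_map N f1 (tangent_comb \<epsilon> (\<lambda>i. X i p)))) \<and>
               (\<Sum>i\<in>UNIV. d_fun (\<lambda>x. f x $ i) (X i p)) =
                 (\<integral>\<epsilon>. pullback f2 \<epsilon> (d_map N f1 (tangent_comb \<epsilon> (\<lambda>i. X i p))) \<partial>\<rho>)))"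
proof (intro conjI allI impI ballI)
  let ?A = "\<lambda>p i j. X j p (\<lambda>x. f x $ i)"
  note trace = has_bochner_integral_trace[OF assms(6,7)]
  fix p
  assume p: "p \<in> points M"
  have pb: "pullback f \<epsilon> (tangent_comb \<epsilon> (\<lambda>i. X i p)) =
      (\<Sum>i\<in>UNIV. \<epsilon> $ i * (\<Sum>j\<in>UNIV. \<epsilon> $ j * ?A p i j))" for \<epsilon>
    by (simp add: pullback_def d_fun_def tangent_comb_def)
  show "integrable \<rho> (\<lambda>\<epsilon>. pullback f \<epsilon> (tangent_comb \<epsilon> (\<lambda>i. X i p)))"
    using trace[of "?A p"] by (simp add: pb has_bochner_integral_iff)
  show "(\<Sum>i\<in>UNIV. d_fun (\<lambda>x. f x $ i) (X i p)) =
      (\<integral>\<epsilon>. pullback f \<epsilon> (tangent_comb \<epsilon> (\<lambda>i. X i p)) \<partial>\<rho>)"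
    using trace[of "?A p"] by (simp add: pb has_bochner_integral_iff d_fun_def)

  fix N :: "('b, 'e2) manifold" and f1 f2
  assume N: "smooth_manifold N" and f2: "smooth_fun N f2"
    and f: "\<forall>p\<in>points M. f p = (f2 \<circ> f1) p"
  \<comment> \<open>The pushforward along \<open>f1\<close> tests \<open>X j p\<close> on this
    composite, which matches the component of \<open>f\<close> only on \<open>points M\<close>;
    \<open>tangent_cong\<close> bridges the gap, starting from the smoothness of
    \<open>f\<close>.\<close>
  have comp: "X j p ((\<lambda>y. f2 y $ i) \<circ> f1) = ?A p i j" for i j
  proof -
    have "X j p \<in> tangent_space M p"
      using assms(2) p by (simp add: smooth_vector_field_def)
    moreover have "smooth_fun M (\<lambda>x. f x $ i)"
      by (rule smooth_fun_bounded_linear[OF bounded_linear_vec_nth assms(1,3)])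
    moreover have "f x $ i = ((\<lambda>y. f2 y $ i) \<circ> f1) x" if "x \<in> points M" for x
      using f that by simp
    ultimately show ?thesis
      by (rule tangent_cong[OF assms(1) p, symmetric])
  qed
  \<comment> \<open>\<open>d_map\<close> returns 0 on non-smooth functions, so this is what selects
    its meaningful branch.\<close>
  have smooth: "smooth_fun N (\<lambda>y. f2 y $ i)" for i
    by (rule smooth_fun_bounded_linear[OF bounded_linear_vec_nth N f2])
  have pb: "pullback f2 \<epsilon> (d_map N f1 (tangent_comb \<epsilon> (\<lambda>i. X i p))) =
      (\<Sum>i\<in>UNIV. \<epsilon> $ i * (\<Sum>j\<in>UNIV. \<epsilon> $ j * ?A p i j))" for \<epsilon>
    by (simp add: pullback_def d_fun_def d_map_def tangent_comb_def smooth comp)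
  show "integrable \<rho> (\<lambda>\<epsilon>. pullback f2 \<epsilon> (d_map N f1 (tangent_comb \<epsilon> (\<lambda>i. X i p))))"
    using trace[of "?A p"] by (simp add: pb has_bochner_integral_iff)
  show "(\<Sum>i\<in>UNIV. d_fun (\<lambda>x. f x $ i) (X i p)) =
      (\<integral>\<epsilon>. pullback f2 \<epsilon> (d_map N f1 (tangent_comb \<epsilon> (\<lambda>i. X i p))) \<partial>\<rho>)"
    using trace[of "?A p"] by (simp add: pb has_bochner_integral_iff d_fun_def)
qed

end
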